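(* As $n\to\infty$, one has $\omega(1)=\chi_{\mu}(Q_{n})=O(\log\log n)$. That is: (i) for every positive integer $q$ there exists $n_0$ such that $\chi_{\mu}(Q_n)>q$ for all integers $n\ge n_0$; and (ii) there exist constants $C>0$ and $n_1$ such that $\chi_{\mu}(Q_n)\le C\log\log n$ for all integers $n\ge n_1$.
   Context: For $n\in\mathbb{N}$, write $[n]=\{1,\dots,n\}$. The $n$-dimensional hypercube $Q_n$ is the graph with vertex set $2^{[n]}$ (all subsets of $[n]$), in which two vertices $A,B\in 2^{[n]}$ are adjacent if and only if their symmetric difference $A\Delta B=(A\setminus B)\cup(B\setminus A)$ has size $1$. For a simple graph $G$, a subset $M\subseteq V(G)$ is a mutual-visibility set in $G$ if for any two vertices $u,v\in M$ there exists a shortest $u$-$v$ path in $G$ that contains no elements of $M$ as internal vertices. The number $\chi_{\mu}(G)$ is the least number of colors needed to color the vertices of $G$ so that each color class is a mutual-visibility set in $G$; equivalently, it is the smallest integer such that $V(G)$ can be partitioned into $\chi_{\mu}(G)$ mutual-visibility sets. Logarithms are in base $2$. *)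

theory Defs
  imports Complex_Main "Graph_Theory.Graph_Theory"
begin

text \<open>
  As usual in \<^theory>\<open>Graph_Theory.Digraph\<close>, a finite simple undirected graph is a finite
  loop-free symmetric digraph without parallel arcs (locale \<^locale>\<open>graph\<close>, respectively
  \<^locale>\<open>pair_graph\<close>).
\<close>

definition hypercube :: "nat \<Rightarrow> nat set pair_pre_digraph" where
  "hypercube n =
     \<lparr> pverts = Pow {1..n},
       parcs = {(A, B). A \<in> Pow {1..n} \<and> B \<in> Pow {1..n} \<and> card ((A - B) \<union> (B - A)) = 1} \<rparr>"

lemma pair_graph_hypercube: "pair_graph (hypercube n)"
proof -
  have "finite (parcs (hypercube n))"
    by (rule finite_subset[of _ "Pow {1..n} \<times> Pow {1..n}"]) (auto simp: hypercube_def)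
  then show ?thesis
    by unfold_locales
      (auto simp: hypercube_def symmetric_def arcs_ends_conv with_proj_def sym_def Un_commute)
qed

definition vpath_between :: "('a, 'b) pre_digraph \<Rightarrow> 'a \<Rightarrow> 'a vwalk \<Rightarrow> 'a \<Rightarrow> bool" where
  "vpath_between G u p v \<longleftrightarrow> vpath p G \<and> hd p = u \<and> last p = v"

definition shortest_vpath :: "('a, 'b) pre_digraph \<Rightarrow> 'a \<Rightarrow> 'a vwalk \<Rightarrow> 'a \<Rightarrow> bool" where
  "shortest_vpath G u p v \<longleftrightarrow>
     vpath_between G u p v \<and> (\<forall>q. vpath_between G u q v \<longrightarrow> vwalk_length p \<le> vwalk_length q)"

definition internal_vertices :: "'a vwalk \<Rightarrow> 'a set" where
  "internal_vertices p = set (butlast (tl p))"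

text \<open>
  The case \<open>u = v\<close> is harmless: the one-vertex path is a shortest path without internal vertices.
\<close>

definition mutual_visibility_set :: "('a, 'b) pre_digraph \<Rightarrow> 'a set \<Rightarrow> bool" where
  "mutual_visibility_set G M \<longleftrightarrow>
     M \<subseteq> verts G \<and>
     (\<forall>u\<in>M. \<forall>v\<in>M. \<exists>p. shortest_vpath G u p v \<and> internal_vertices p \<inter> M = {})"

definition mutual_visibility_coloring ::
    "('a, 'b) pre_digraph \<Rightarrow> nat \<Rightarrow> ('a \<Rightarrow> nat) \<Rightarrow> bool" where
  "mutual_visibility_coloring G k c \<longleftrightarrow>
     c ` verts G \<subseteq> {..<k} \<and> (\<forall>i<k. mutual_visibility_set G {v \<in> verts G. c v = i})"

text \<open>
  Colours may remain unused (the empty set is a mutual-visibility set); this does not affect the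
  minimum. The minimum is over a nonempty set for every finite graph, as shown below.
\<close>

definition mutual_visibility_chromatic_number :: "('a, 'b) pre_digraph \<Rightarrow> nat" ("\<chi>\<^sub>\<mu>") where
  "\<chi>\<^sub>\<mu> G = (LEAST k. \<exists>c. mutual_visibility_coloring G k c)"

lemma mutual_visibility_set_empty: "mutual_visibility_set G {}"
  by (simp add: mutual_visibility_set_def)

lemma mutual_visibility_set_singleton:
  assumes "v \<in> verts G"
  shows "mutual_visibility_set G {v}"
proof -
  have "shortest_vpath G v [v] v"
    using assms by (auto simp: shortest_vpath_def vpath_between_def vpath_def vwalk_def)
  then show ?thesis
    using assms by (auto simp: mutual_visibility_set_def internal_vertices_def intro!: exI[of _ "[v]"])
qed

lemma mutual_visibility_coloring_exists:
  assumes "finite (verts G)"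
  shows "\<exists>k c. mutual_visibility_coloring G k c"
proof -
  obtain c where c: "bij_betw c (verts G) {0..<card (verts G)}"
    using assms ex_bij_betw_finite_nat by blast
  have "mutual_visibility_set G {v \<in> verts G. c v = i}" if "i < card (verts G)" for i
  proof -
    obtain v where v: "v \<in> verts G" "c v = i"
      using c \<open>i < card (verts G)\<close> by (metis atLeast0LessThan bij_betw_def imageE lessThan_iff)
    then have "{w \<in> verts G. c w = i} = {v}"
      using c by (auto simp: bij_betw_def inj_on_def)
    with v show ?thesis
      by (simp add: mutual_visibility_set_singleton)
  qed
  then have "mutual_visibility_coloring G (card (verts G)) c"
    using c by (auto simp: mutual_visibility_coloring_def bij_betw_def)
  then show ?thesis by blast
qed

lemma mutual_visibility_chromatic_number_attained:
  assumes "finite (verts G)"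
  shows "\<exists>c. mutual_visibility_coloring G (\<chi>\<^sub>\<mu> G) c"
  unfolding mutual_visibility_chromatic_number_def
  using mutual_visibility_coloring_exists[OF assms] by (rule LeastI_ex)

end

theory Submission
  imports Defs "HOL-Library.Ramsey" "HOL.Binomial_Plus"
begin

text \<open>
  Lower bound: for a colouring with \<open>q\<close> colours and large \<open>n\<close>, iterated Ramsey gives
  \<open>S \<subseteq> {1..n}\<close> with \<open>2 * q\<close> elements such that the colour of a subset of \<open>S\<close> depends only on its
  size. Three of the \<open>2 * q + 1\<close> sizes share a colour. If \<open>X \<subseteq> Y \<subseteq> S\<close> have the smallest and the
  largest of them, then every shortest path from \<open>X\<close> to \<open>Y\<close> passes through a subset of \<open>S\<close> of the
  middle size, so this colour class is not a mutual-visibility set.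

  Upper bound: colour \<open>X\<close> by \<open>card X mod (4 * K)\<close> together with the bit \<open>\<phi> (\<Sum>x\<in>X. h x)\<close>. Here
  \<open>h\<close> takes values polynomial in \<open>n\<close> (for fixed \<open>K\<close>) and has distinct sums over the sets of at most
  \<open>K\<close> elements, so the \<open>K\<close>-subsets of a \<open>2 * K\<close>-set \<open>D\<close> produce \<open>2 * K choose K\<close> different sums.
  A union bound over all \<open>D\<close> and all translates, of which there are only \<open>n ^ O(K)\<close>, yields a \<open>\<phi>\<close> that
  is never constant on these translated sums as soon as \<open>K\<close> is about \<open>log log n\<close>. Hence a path
  crossing a layer of its own class monotonically can be rerouted around the class.
\<close>

section \<open>Geodesics in the hypercube\<close>

lemma verts_hypercube [simp]: "pverts (hypercube n) = Pow {1..n}"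
  by (simp add: hypercube_def)

lemma parcs_hypercube:
  "(X, Y) \<in> parcs (hypercube n) \<longleftrightarrow> X \<subseteq> {1..n} \<and> Y \<subseteq> {1..n} \<and> card (sym_diff X Y) = 1"
  by (simp add: hypercube_def)

lemma card_sym_diff_triangle:
  assumes "finite A" "finite B" "finite C"
  shows "card (sym_diff A C) \<le> card (sym_diff A B) + card (sym_diff B C)"
proof -
  have "card (sym_diff A C) \<le> card (sym_diff A B \<union> sym_diff B C)"
    using assms by (intro card_mono) auto
  also have "\<dots> \<le> card (sym_diff A B) + card (sym_diff B C)"
    by (rule card_Un_le)
  finally show ?thesis .
qed

lemma vwalk_arcs_nth:
  "Suc i < length p \<Longrightarrow> (p ! i, p ! Suc i) \<in> set (vwalk_arcs p)"
proof (induction p arbitrary: i rule: vwalk_arcs.induct)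
  case (3 x y xs)
  then show ?case by (cases i) auto
qed auto

lemma set_vwalk_arcs_rev: "set (vwalk_arcs (rev p)) = prod.swap ` set (vwalk_arcs p)"
proof (induction p rule: vwalk_arcs.induct)
  case (3 x y xs)
  have "set (vwalk_arcs (rev (y # xs) @ [x])) = insert (y, x) (set (vwalk_arcs (rev (y # xs))))"
    by (subst vwalk_arcs_append) auto
  then show ?case using 3 by auto
qed auto

lemma hypercube_vwalk_finite:
  assumes "vwalk p (hypercube n)" "X \<in> set p"
  shows "X \<subseteq> {1..n}" "finite X"
proof -
  show "X \<subseteq> {1..n}" using assms by (auto simp: vwalk_def)
  then show "finite X" using finite_subset by blast
qed

lemma hypercube_vwalk_dist_le:
  assumes "vwalk p (hypercube n)" "i \<le> j" "j < length p"
  shows "card (sym_diff (p ! i) (p ! j)) \<le> j - i"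
  using assms(2,3)
proof (induction j rule: dec_induct)
  case (step m)
  have "(p ! m, p ! Suc m) \<in> parcs (hypercube n)"
    using assms(1) vwalk_arcs_nth[of m p] step.prems by (auto simp: vwalk_def)
  then have "card (sym_diff (p ! m) (p ! Suc m)) = 1"
    by (simp add: parcs_hypercube)
  moreover have "card (sym_diff (p ! i) (p ! Suc m)) \<le>
      card (sym_diff (p ! i) (p ! m)) + card (sym_diff (p ! m) (p ! Suc m))"
    using step hypercube_vwalk_finite(2)[OF assms(1)] by (intro card_sym_diff_triangle) auto
  moreover have "card (sym_diff (p ! i) (p ! m)) \<le> m - i" using step by simp
  ultimately show ?case using step.hyps by linarith
qed simp

lemma hypercube_vwalk_length_ge:
  assumes "vwalk p (hypercube n)"
  shows "Suc (card (sym_diff (hd p) (last p))) \<le> length p"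
proof -
  have "p \<noteq> []" using assms by auto
  then show ?thesis
    using hypercube_vwalk_dist_le[OF assms, of 0 "length p - 1"]
    by (cases p) (auto simp: hd_conv_nth last_conv_nth)
qed

text \<open>Minimality is encoded as the number of vertices prescribed by the Hamming distance;
  distinctness of \<open>p\<close> is a consequence.\<close>

definition geodesic :: "nat \<Rightarrow> nat set \<Rightarrow> nat set list \<Rightarrow> nat set \<Rightarrow> bool" where
  "geodesic n X p Y \<longleftrightarrow> vwalk p (hypercube n) \<and> hd p = X \<and> last p = Y \<and>
     length p = Suc (card (sym_diff X Y))"

text \<open>The two parts of the walk bound the two distances from above, and the triangle
  inequality leaves no slack since the whole walk has minimal length.\<close>

lemma geodesic_dist:
  assumes "geodesic n X p Y" "i < length p"
  shows "card (sym_diff X (p ! i)) = i" "card (sym_diff (p ! i) Y) = length p - 1 - i"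
proof -
  have p: "vwalk p (hypercube n)" "p \<noteq> []" using assms by (auto simp: geodesic_def)
  have ends: "X = p ! 0" "Y = p ! (length p - 1)"
    using assms(1) hd_conv_nth[OF p(2)] last_conv_nth[OF p(2)] unfolding geodesic_def by metis+
  have "card (sym_diff X (p ! i)) \<le> i" "card (sym_diff (p ! i) Y) \<le> length p - 1 - i"
    using hypercube_vwalk_dist_le[OF p(1), of 0 i] hypercube_vwalk_dist_le[OF p(1), of i "length p - 1"]
      assms(2) by (auto simp: ends)
  moreover have "card (sym_diff X Y) \<le> card (sym_diff X (p ! i)) + card (sym_diff (p ! i) Y)"
    using hypercube_vwalk_finite(2)[OF p(1)] assms(2) p(2)
    by (intro card_sym_diff_triangle) (auto simp: ends)
  moreover have "length p = Suc (card (sym_diff X Y))"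
    using assms(1) by (simp add: geodesic_def)
  ultimately show "card (sym_diff X (p ! i)) = i" "card (sym_diff (p ! i) Y) = length p - 1 - i"
    using assms(2) by linarith+
qed

lemma geodesic_shortest_vpath:
  assumes "geodesic n X p Y"
  shows "shortest_vpath (hypercube n) X p Y"
proof -
  have "distinct p"
    unfolding distinct_conv_nth using geodesic_dist(1)[OF assms] by metis
  then have "vpath_between (hypercube n) X p Y"
    using assms by (simp add: vpath_between_def geodesic_def vpath_def)
  moreover have "vwalk_length p \<le> vwalk_length q" if "vpath_between (hypercube n) X q Y" for q
  proof -
    have "vwalk q (hypercube n)" "hd q = X" "last q = Y"
      using that by (auto simp: vpath_between_def)
    then have "Suc (card (sym_diff X Y)) \<le> length q"
      using hypercube_vwalk_length_ge by blast
    then show ?thesis using assms by (simp add: geodesic_def)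
  qed
  ultimately show ?thesis by (simp add: shortest_vpath_def)
qed

section \<open>Visibility along geodesics\<close>

definition visible :: "nat \<Rightarrow> nat set set \<Rightarrow> nat set \<Rightarrow> nat set \<Rightarrow> bool" where
  "visible n M X Y \<longleftrightarrow> (\<exists>p. geodesic n X p Y \<and> internal_vertices p \<inter> M = {})"

lemma visible_refl: "X \<subseteq> {1..n} \<Longrightarrow> visible n M X X"
  unfolding visible_def
  by (intro exI[of _ "[X]"]) (auto simp: geodesic_def internal_vertices_def vwalk_def)

lemma visible_edge:
  assumes "X \<subseteq> {1..n}" "Y \<subseteq> {1..n}" "card (sym_diff X Y) = 1"
  shows "visible n M X Y"
  unfolding visible_def
  using assms by (intro exI[of _ "[X, Y]"])
    (auto simp: geodesic_def internal_vertices_def vwalk_def parcs_hypercube)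

lemma visible_sym:
  assumes "visible n M X Y"
  shows "visible n M Y X"
proof -
  obtain p where p: "geodesic n X p Y" "internal_vertices p \<inter> M = {}"
    using assms by (auto simp: visible_def)
  have "vwalk (rev p) (hypercube n)"
    using p(1) by (auto simp: geodesic_def vwalk_def set_vwalk_arcs_rev parcs_hypercube Un_commute)
  then have "geodesic n Y (rev p) X"
    using p(1) by (auto simp: geodesic_def hd_rev last_rev Un_commute)
  moreover have "internal_vertices (rev p) = internal_vertices p"
    by (cases p rule: rev_cases) (simp_all add: internal_vertices_def butlast_rev butlast_tl)
  ultimately show ?thesis using p(2) by (auto simp: visible_def)
qed

text \<open>The hypothesis \<open>dist\<close> makes the concatenation a geodesic again;
  \<open>Z\<close> may become one of its internal vertices, hence
  \<open>Z \<notin> M\<close>.\<close>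

lemma visible_trans:
  assumes "visible n M X Z" "visible n M Z Y" "Z \<notin> M"
    and dist: "card (sym_diff X Z) + card (sym_diff Z Y) = card (sym_diff X Y)"
  shows "visible n M X Y"
proof -
  obtain p where p: "geodesic n X p Z" "internal_vertices p \<inter> M = {}"
    using assms by (auto simp: visible_def)
  obtain q where q: "geodesic n Z q Y" "internal_vertices q \<inter> M = {}"
    using assms by (auto simp: visible_def)
  obtain p' where p': "p = p' @ [Z]"
    using p(1) by (cases p rule: rev_cases) (auto simp: geodesic_def)
  obtain q' where q': "q = Z # q'"
    using q(1) by (cases q) (auto simp: geodesic_def)
  have "set (vwalk_arcs (p' @ Z # q')) = set (vwalk_arcs p) \<union> set (vwalk_arcs q)"
    unfolding p' q' by (cases "p' = []") (auto simp: vwalk_arcs_append)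
  then have "geodesic n X (p' @ Z # q') Y"
    using p(1) q(1) dist unfolding geodesic_def vwalk_def p' q' by (auto simp: hd_append)
  moreover have "internal_vertices (p' @ Z # q') \<subseteq> insert Z (internal_vertices p \<union> internal_vertices q)"
    unfolding p' q' by (cases p')
      (auto simp: internal_vertices_def butlast_append split: if_splits dest: in_set_butlastD)
  ultimately show ?thesis
    using p(2) q(2) \<open>Z \<notin> M\<close> unfolding visible_def by (intro exI[of _ "p' @ Z # q'"]) blast
qed

lemma card_sym_diff_subset: "X \<subseteq> Y \<Longrightarrow> finite Y \<Longrightarrow> card (sym_diff X Y) = card Y - card X"
  by (metis Diff_eq_empty_iff Un_empty_left card_Diff_subset finite_subset)

lemma visible_trans_chain:
  assumes "visible n M X Z" "visible n M Z Y" "Z \<notin> M" "X \<subseteq> Z" "Z \<subseteq> Y" "Y \<subseteq> {1..n}"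
  shows "visible n M X Y"
proof (rule visible_trans[OF assms(1-3)])
  have "finite Y" "finite Z" using assms finite_subset by (meson finite_atLeastAtMost)+
  then show "card (sym_diff X Z) + card (sym_diff Z Y) = card (sym_diff X Y)"
    using assms card_mono[of Y Z] card_mono[of Z X] by (simp add: card_sym_diff_subset)
qed

text \<open>Inserting the elements of \<open>Y - X\<close> one at a time gives a geodesic whose
  internal vertices all lie strictly between \<open>X\<close> and \<open>Y\<close>.\<close>

lemma visible_chain:
  assumes "X \<subseteq> Y" "Y \<subseteq> {1..n}" "\<And>Z. X \<subset> Z \<Longrightarrow> Z \<subset> Y \<Longrightarrow> Z \<notin> M"
  shows "visible n M X Y"
  using assms
proof (induction "card Y - card X" arbitrary: X rule: less_induct)
  case less
  have fin: "finite Y" "finite X" using less.prems finite_subset by (meson finite_atLeastAtMost)+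
  show ?case
  proof (cases "X = Y")
    case True
    then show ?thesis using less.prems by (simp add: visible_refl)
  next
    case False
    then obtain y where y: "y \<in> Y" "y \<notin> X" using less.prems by auto
    have "sym_diff X (insert y X) = {y}" using y by auto
    then have step: "visible n M X (insert y X)"
      using less.prems y by (intro visible_edge) auto
    show ?thesis
    proof (cases "insert y X = Y")
      case True
      then show ?thesis using step by simp
    next
      case neq: False
      have "card X < card Y" using False less.prems fin by (intro psubset_card_mono) auto
      then have "visible n M (insert y X) Y"
        using less.prems y fin by (intro less.hyps) (auto simp: card_insert_if)
      moreover have "X \<subset> insert y X" "insert y X \<subset> Y"
        using less.prems(1) y neq by auto
      ultimately show ?thesis
        using step less.prems(2) less.prems(3)[of "insert y X"]
          visible_trans_chain[of n M X "insert y X" Y] by blast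
    qed
  qed
qed

section \<open>Mutual visibility of layered sets\<close>

text \<open>
  The assumption \<open>reroute\<close> lets a path that crosses a layer of \<open>M\<close> with \<open>K\<close> steps in the same
  direction before and after the crossing avoid \<open>M\<close> by reordering these \<open>2 * K\<close> steps.
\<close>

locale layered_set =
  fixes n K r :: nat and M :: "nat set set"
  assumes K_pos: "K > 0"
    and M_sub: "X \<in> M \<Longrightarrow> X \<subseteq> {1..n}"
    and M_layer: "X \<in> M \<Longrightarrow> card X mod (4 * K) = r"
    and reroute: "Z \<subseteq> {1..n} \<Longrightarrow> D \<subseteq> {1..n} - Z \<Longrightarrow> card D = 2 * K \<Longrightarrow>
      \<exists>W\<subseteq>D. card W = K \<and> Z \<union> W \<notin> M"
begin

text \<open>Subtraction on \<open>nat\<close> is truncated, so for \<open>x < y\<close> this is the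
  divisibility of 0 and carries no information.\<close>

lemma layers_dvd: "x mod (4 * K) = r \<Longrightarrow> y mod (4 * K) = r \<Longrightarrow> 4 * K dvd x - y"
  using mod_eq_dvd_iff_nat[of y x "4 * K"] by (cases "y \<le> x") simp_all

text \<open>The layers strictly between are crossed from bottom to top, each at a set outside
  \<open>M\<close> found by \<open>reroute\<close>. The last hypothesis leaves \<open>K\<close>
  steps on either side of a layer; the rest of the path inherits it because consecutive layers are
  \<open>4 * K\<close> apart.\<close>

lemma visible_monotone:
  assumes "X \<subseteq> Y" "Y \<subseteq> {1..n}"
    and "\<And>m. card X < m \<Longrightarrow> m < card Y \<Longrightarrow> m mod (4 * K) = r \<Longrightarrow> card X + K \<le> m \<and> m + K \<le> card Y"
  shows "visible n M X Y"
  using assms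
proof (induction "card Y - card X" arbitrary: X rule: less_induct)
  case less
  have fin: "finite Y" "finite X" using less.prems finite_subset by (meson finite_atLeastAtMost)+
  define P where "P m \<longleftrightarrow> card X < m \<and> m < card Y \<and> m mod (4 * K) = r" for m
  show ?case
  proof (cases "\<exists>m. P m")
    case False
    show ?thesis
    proof (rule visible_chain[OF less.prems(1,2)])
      fix Z assume "X \<subset> Z" "Z \<subset> Y"
      then have "card X < card Z" "card Z < card Y"
        using fin finite_subset[of Z Y] by (auto intro: psubset_card_mono)
      then show "Z \<notin> M" using False M_layer by (auto simp: P_def)
    qed
  next
    case True
    define m where "m = (LEAST m. P m)"
    have Pm: "P m" unfolding m_def using True by (rule LeastI_ex)
    have least: "\<not> P m'" if "m' < m" for m' using that unfolding m_def by (rule not_less_Least)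
    have m: "card X + K \<le> m" "m + K \<le> card Y" "m mod (4 * K) = r"
      using Pm less.prems(3) by (auto simp: P_def)
    \<comment> \<open>The rerouted block starts \<open>K\<close> below the layer, so adding any
      \<open>K\<close> of its \<open>2 * K\<close> elements lands exactly on height
      \<open>m\<close>.\<close>
    obtain Z0 where Z0: "X \<subseteq> Z0" "Z0 \<subseteq> Y" "card Z0 = m - K"
      using exists_subset_between[of X "m - K" Y] m(1,2) less.prems(1) fin
      by (metis add_leD1 add_le_imp_le_diff diff_le_self le_trans)
    have "2 * K \<le> card (Y - Z0)"
      using Z0 m fin finite_subset[of Z0 Y] by (simp add: card_Diff_subset)
    then obtain D where D: "D \<subseteq> Y - Z0" "card D = 2 * K"
      using obtain_subset_with_card_n by metis
    then obtain W where W: "W \<subseteq> D" "card W = K" "Z0 \<union> W \<notin> M"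
      using reroute[of Z0 D] Z0 less.prems(2) by blast
    define Z where "Z = Z0 \<union> W"
    have Z: "X \<subseteq> Z" "Z \<subseteq> Y" "Z \<notin> M" using Z0 W D by (auto simp: Z_def)
    have finZ: "finite Z0" "finite W" "finite Z"
      using Z0(2) W(1) D(1) Z(2) fin(1) by (meson Diff_subset finite_subset subset_trans)+
    have "Z0 \<inter> W = {}" using W(1) D(1) by auto
    then have cardZ: "card Z = m"
      unfolding Z_def using card_Un_disjoint[OF finZ(1,2)] Z0(3) W(2) m(1) by simp
    have "visible n M X Z"
    proof (rule visible_chain)
      fix V assume "X \<subset> V" "V \<subset> Z"
      then have "card X < card V" "card V < m"
        using finZ(3) finite_subset[of V Z] psubset_card_mono[of V X] psubset_card_mono[of Z V] cardZ
        by auto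
      then show "V \<notin> M" using least[of "card V"] Pm M_layer by (auto simp: P_def)
    qed (use Z less.prems in auto)
    moreover have "visible n M Z Y"
    proof (rule less.hyps)
      show "card Y - card Z < card Y - card X" using cardZ Pm by (auto simp: P_def)
      fix m' assume m': "card Z < m'" "m' < card Y" "m' mod (4 * K) = r"
      have "4 * K dvd m' - m" using m'(3) m(3) by (rule layers_dvd)
      then have "4 * K \<le> m' - m" using m' cardZ by (intro dvd_imp_le) auto
      then show "card Z + K \<le> m' \<and> m' + K \<le> card Y"
        using less.prems(3)[of m'] m' cardZ Pm by (auto simp: P_def)
    qed (use Z less.prems in auto)
    ultimately show ?thesis
      using Z less.prems(2) visible_trans_chain[of n M X Z Y] by blast
  qed
qed

text \<open>A crossed layer is at least \<open>4 * K\<close> above \<open>X\<close>, so only its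
  distance to \<open>Y\<close> could be too short. If \<open>d < 4 * K\<close>, no layer is crossed;
  otherwise that distance is congruent to \<open>d\<close> and hence at least
  \<open>K\<close>.\<close>

lemma visible_from_layer:
  assumes "X \<subseteq> Y" "Y \<subseteq> {1..n}" "card X mod (4 * K) = r"
    and d: "card Y = card X + d" "d < 4 * K \<or> K \<le> d mod (4 * K)"
  shows "visible n M X Y"
proof (rule visible_monotone[OF assms(1,2)])
  fix m assume m: "card X < m" "m < card Y" "m mod (4 * K) = r"
  have "4 * K dvd m - card X" using m(3) assms(3) by (rule layers_dvd)
  then obtain c where "m - card X = 4 * K * c" ..
  then have c: "m = card X + 4 * K * c" using m by simp
  then have "c \<noteq> 0" using m by (intro notI) simp
  then have ge: "4 * K \<le> 4 * K * c" by simp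
  then have "K \<le> d mod (4 * K)" using d m c by linarith
  also have "d = (card Y - m) + 4 * K * c" using d c m by simp
  then have "d mod (4 * K) = (card Y - m) mod (4 * K)" by simp
  also have "\<dots> \<le> card Y - m" by (rule mod_less_eq_dividend)
  finally show "card X + K \<le> m \<and> m + K \<le> card Y" using m ge c by linarith
qed

text \<open>Mirror image of \<open>visible_from_layer\<close>: the top end lies on a layer, and the
  room of \<open>K\<close> has to be found above \<open>X\<close>.\<close>

lemma visible_to_layer:
  assumes "X \<subseteq> Y" "Y \<subseteq> {1..n}" "card Y mod (4 * K) = r"
    and d: "card Y = card X + d" "d < 4 * K \<or> K \<le> d mod (4 * K)"
  shows "visible n M X Y"
proof (rule visible_monotone[OF assms(1,2)])
  fix m assume m: "card X < m" "m < card Y" "m mod (4 * K) = r"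
  have "4 * K dvd card Y - m" using assms(3) m(3) by (rule layers_dvd)
  then obtain c where "card Y - m = 4 * K * c" ..
  then have c: "card Y = m + 4 * K * c" using m by simp
  then have "c \<noteq> 0" using m by (intro notI) simp
  then have ge: "4 * K \<le> 4 * K * c" by simp
  then have "K \<le> d mod (4 * K)" using d m c by linarith
  also have "d = (m - card X) + 4 * K * c" using d c m by simp
  then have "d mod (4 * K) = (m - card X) mod (4 * K)" by simp
  also have "\<dots> \<le> m - card X" by (rule mod_less_eq_dividend)
  finally show "card X + K \<le> m \<and> m + K \<le> card Y" using m ge c by linarith
qed

text \<open>
  The path climbs by \<open>x\<close>, descends by \<open>card (A - B)\<close> and climbs to \<open>B\<close>. The height \<open>x\<close> is
  \<open>card (B - A)\<close>, unless that puts the turning point less than \<open>K\<close> away from a layer of \<open>M\<close>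
  other than that of \<open>A\<close>; then it is \<open>2 * K\<close>.
\<close>

lemma visible_ordered:
  assumes A: "A \<in> M" and B: "B \<in> M" and le: "card (A - B) \<le> card (B - A)"
  shows "visible n M A B"
proof (cases "A = B")
  case True
  then show ?thesis using M_sub[OF A] by (simp add: visible_refl)
next
  case neq: False
  note sub = M_sub[OF A] M_sub[OF B]
  have fin: "finite A" "finite B" using sub finite_subset by blast+
  define a b where "a = card (A - B)" and "b = card (B - A)"
  have cards: "card A = card (A \<inter> B) + a" "card B = card (A \<inter> B) + b"
    using fin card_Diff_subset_Int[of A B] card_Diff_subset_Int[of B A]
      card_mono[of A "A \<inter> B"] card_mono[of B "A \<inter> B"]
    by (auto simp: a_def b_def Int_commute)
  have r: "card A mod (4 * K) = r" "card B mod (4 * K) = r" using A B M_layer by auto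
  have ab: "a \<le> b" using le by (simp add: a_def b_def)
  have "4 * K dvd card B - card A" using r(2,1) by (rule layers_dvd)
  then have dvd: "4 * K dvd b - a" using cards by simp
  then have mod_eq: "b mod (4 * K) = a mod (4 * K)" using dvd ab mod_eq_dvd_iff_nat[of a b "4 * K"] by simp
  have "b > 0" using ab neq fin by (auto simp: a_def b_def)
  have dist: "card (sym_diff A B) = a + b"
    unfolding a_def b_def using fin by (intro card_Un_disjoint) auto
  have cardU: "card (A \<union> B) = card A + b" "card (A \<union> B) = card B + a"
    using fin cards card_Un_Int[of A B] by auto
  show ?thesis
  \<comment> \<open>As \<open>a \<le> b\<close> have the same residue, one test on \<open>b\<close>
    decides whether \<open>A \<union> B\<close> can be the turning point for both monotone
    pieces.\<close>
  proof (cases "b < 2 * K \<or> K \<le> b mod (4 * K) \<and> b mod (4 * K) \<le> 3 * K")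
    case True
    have b_mod: "b mod (4 * K) \<noteq> 0" using True \<open>b > 0\<close> K_pos by auto
    have ds: "b < 4 * K \<or> K \<le> b mod (4 * K)" using True by auto
    have "visible n M A (A \<union> B)"
      using sub r cardU ds by (intro visible_from_layer[of A "A \<union> B" b]) auto
    moreover have "visible n M B (A \<union> B)"
      using sub r cardU ds mod_eq ab by (intro visible_from_layer[of B "A \<union> B" a]) auto
    moreover have "A \<union> B \<notin> M"
    proof
      assume "A \<union> B \<in> M"
      then have "4 * K dvd card (A \<union> B) - card A"
        using M_layer r(1) layers_dvd by blast
      then show False using cardU b_mod by auto
    qed
    moreover have "card (sym_diff A (A \<union> B)) + card (sym_diff (A \<union> B) B) = card (sym_diff A B)"
    proof -
      have "sym_diff A (A \<union> B) = B - A" "sym_diff (A \<union> B) B = A - B" by auto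
      then show ?thesis using dist by (simp only: a_def b_def)
    qed
    ultimately show ?thesis
      using visible_trans visible_sym by blast
  next
    case False
    then have big: "2 * K \<le> b" and amod: "a mod (4 * K) < K \<or> 3 * K < a mod (4 * K)"
      using mod_eq by auto
    obtain E where E: "E \<subseteq> B - A" "card E = 2 * K"
      using obtain_subset_with_card_n[of "2 * K" "B - A"] big by (auto simp: b_def)
    have finE: "finite E" using E fin finite_subset by blast
    \<comment> \<open>From \<open>A\<close> the path adds \<open>E\<close>, removes
      \<open>A - B\<close> and then adds the rest of \<open>B - A\<close>; \<open>X\<close> and
      \<open>Y\<close> are its turning points.\<close>
    define X where "X = A \<union> E"
    define Y where "Y = (A \<inter> B) \<union> E"
    have cX: "card X = card A + 2 * K"
      unfolding X_def using E fin finE by (subst card_Un_disjoint) auto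
    have cY: "card Y = card (A \<inter> B) + 2 * K"
      unfolding Y_def using E fin finE by (subst card_Un_disjoint) auto
    have X: "A \<subseteq> X" "X \<subseteq> {1..n}" and Y: "Y \<subseteq> X" "Y \<subseteq> B" "Y \<subseteq> {1..n}" "finite X" "finite Y"
      using E sub fin finE by (auto simp: X_def Y_def)
    have XM: "X \<notin> M"
    proof
      assume "X \<in> M"
      then have "4 * K dvd card X - card A"
        using M_layer r(1) layers_dvd by blast
      then have "4 * K \<le> 2 * K" using cX K_pos by (intro dvd_imp_le) auto
      then show False using K_pos by simp
    qed
    have YM: "Y \<notin> M"
    proof
      assume "Y \<in> M"
      then have "4 * K dvd card Y - card A" "4 * K dvd card A - card Y"
        using M_layer r(1) layers_dvd by blast+
      then have d: "4 * K dvd 2 * K - a" "4 * K dvd a - 2 * K" using cY cards by simp_all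
      have "a mod (4 * K) = 2 * K"
      proof (cases "a < 2 * K")
        case True
        then show ?thesis using dvd_imp_le[OF d(1)] K_pos by simp
      next
        case False
        then have "a mod (4 * K) = 2 * K mod (4 * K)"
          using d(2) mod_eq_dvd_iff_nat[of "2 * K" a "4 * K"] by simp
        then show ?thesis using K_pos by simp
      qed
      then show False using amod by simp
    qed
    have AX: "visible n M A X"
      using X r cX K_pos by (intro visible_from_layer[of A X "2 * K"]) auto
    \<comment> \<open>The next layer above \<open>A\<close> is above \<open>X\<close>, so a crossed
      layer is at most at height \<open>card A\<close> and has \<open>2 * K\<close> steps above it.
      Fewer than \<open>K\<close> steps below it would give \<open>a\<close> a residue in the range
      from \<open>2 * K\<close> to below \<open>3 * K\<close>, against \<open>amod\<close>.\<close>
    have XY: "visible n M Y X"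
    proof (rule visible_monotone)
      fix m assume m: "card Y < m" "m < card X" "m mod (4 * K) = r"
      define e where "e = m - card Y"
      have mA: "m \<le> card A"
      proof (rule ccontr)
        assume "\<not> m \<le> card A"
        moreover have "4 * K dvd m - card A" using m(3) r(1) by (rule layers_dvd)
        ultimately have "4 * K \<le> m - card A" by (intro dvd_imp_le) auto
        then show False using m cX K_pos by linarith
      qed
      have "4 * K dvd card A - m" using r(1) m(3) by (rule layers_dvd)
      then obtain c where "card A - m = 4 * K * c" ..
      then have "a = e + 2 * K + 4 * K * c" using m mA cY cards by (simp add: e_def)
      then have "a mod (4 * K) = (e + 2 * K) mod (4 * K)" by simp
      then have "K \<le> e" using amod m K_pos by (cases "e < K") (auto simp: e_def)
      then show "card Y + K \<le> m \<and> m + K \<le> card X" using m mA cX by (simp add: e_def)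
    qed (use X Y in auto)
    have YB: "visible n M Y B"
    proof (rule visible_to_layer[of Y B "b - 2 * K"])
      \<comment> \<open>A residue of \<open>b - 2 * K\<close> below \<open>K\<close> would put that
        of \<open>b\<close> into the range of the case already treated.\<close>
      have "K \<le> (b - 2 * K) mod (4 * K)" if "\<not> b - 2 * K < 4 * K"
      proof (rule ccontr)
        assume *: "\<not> K \<le> (b - 2 * K) mod (4 * K)"
        have "b mod (4 * K) = ((b - 2 * K) mod (4 * K) + 2 * K) mod (4 * K)"
          using big by (simp add: mod_add_left_eq)
        also have "\<dots> = (b - 2 * K) mod (4 * K) + 2 * K" using * by simp
        finally show False using False * by simp
      qed
      then show "b - 2 * K < 4 * K \<or> K \<le> (b - 2 * K) mod (4 * K)" by blast
    qed (use Y sub r cY cards big in auto)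
    have XB: "visible n M X B"
    proof (rule visible_trans[OF visible_sym[OF XY] YB YM])
      have "sym_diff X Y = A - B" "sym_diff Y B = B - A - E" "sym_diff X B = (A - B) \<union> (B - A - E)"
        using E by (auto simp: X_def Y_def)
      then show "card (sym_diff X Y) + card (sym_diff Y B) = card (sym_diff X B)"
        using fin by (simp add: card_Un_disjoint disjoint_iff)
    qed
    show ?thesis
    proof (rule visible_trans[OF AX XB XM])
      have "sym_diff A X = E" "sym_diff X B = (A - B) \<union> (B - A - E)"
        using E by (auto simp: X_def)
      moreover have "card ((A - B) \<union> (B - A - E)) = a + (b - 2 * K)"
        using fin E finE by (subst card_Un_disjoint) (auto simp: a_def b_def card_Diff_subset)
      ultimately show "card (sym_diff A X) + card (sym_diff X B) = card (sym_diff A B)"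
        using dist E big by simp
    qed
  qed
qed

lemma mutual_visibility: "mutual_visibility_set (hypercube n) M"
proof -
  have "visible n M A B" if "A \<in> M" "B \<in> M" for A B
    using visible_ordered[of A B] visible_ordered[of B A] visible_sym that by (meson nat_le_linear)
  then show ?thesis
    using M_sub geodesic_shortest_vpath
    unfolding mutual_visibility_set_def visible_def by (simp add: subset_iff) blast
qed

end

section \<open>Colourings that are not constant on subset sums\<close>

text \<open>An enumeration of \<open>S\<close> is padded with 0 to length \<open>k\<close>; as 0
  lies outside \<open>{1..n}\<close>, deleting it recovers \<open>S\<close>.\<close>

lemma card_bounded_subsets_le:
  "card {S. S \<subseteq> {1..n::nat} \<and> card S \<le> k} \<le> (n + 1) ^ k"
proof -
  have "S \<in> (\<lambda>xs. set xs - {0}) ` {xs. set xs \<subseteq> {0..n} \<and> length xs = k}"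
    if S: "S \<subseteq> {1..n}" "card S \<le> k" for S
  proof -
    obtain ys where ys: "set ys = S" "length ys = card S"
      using S finite_subset finite_distinct_list distinct_card by (metis finite_atLeastAtMost)
    have "set (ys @ replicate (k - card S) 0) - {0} = S"
      using S ys by (auto dest: subsetD)
    moreover have "set (ys @ replicate (k - card S) 0) \<subseteq> {0..n}"
      using S ys by auto
    ultimately show ?thesis
      using S ys by (intro image_eqI[of _ _ "ys @ replicate (k - card S) 0"]) auto
  qed
  then have "{S. S \<subseteq> {1..n} \<and> card S \<le> k} \<subseteq>
      (\<lambda>xs. set xs - {0}) ` {xs. set xs \<subseteq> {0..n} \<and> length xs = k}"
    by blast
  then have "card {S. S \<subseteq> {1..n} \<and> card S \<le> k} \<le> card {xs. set xs \<subseteq> {0..n} \<and> length xs = k}"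
    by (intro surj_card_le) (simp_all add: finite_lists_length_eq)
  then show ?thesis
    by (simp add: card_lists_length_eq)
qed

text \<open>Greedy choice: the value at a new element has to avoid the differences of old sums,
  which are fewer than the available values. Fixing \<open>N\<close> keeps the bound the same
  throughout the induction on \<open>n\<close>.\<close>

lemma exists_distinct_subset_sums:
  assumes "n \<le> N"
  shows "\<exists>h :: nat \<Rightarrow> nat. (\<forall>x. h x \<le> (N + 1) ^ (2 * k)) \<and>
           inj_on (sum h) {S. S \<subseteq> {1..n} \<and> card S \<le> k}"
  using assms
proof (induction n)
  case 0
  then show ?case
    by (intro exI[of _ "\<lambda>_. 0"]) (auto simp: inj_on_def)
next
  case (Suc n)
  then obtain h where h: "\<forall>x. h x \<le> (N + 1) ^ (2 * k)"
      "inj_on (sum h) {S. S \<subseteq> {1..n} \<and> card S \<le> k}" (is "inj_on _ ?F")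
    by auto
  \<comment> \<open>Negative differences are truncated to 0, a value that \<open>S = S'\<close>
    forbids anyway.\<close>
  define bad where "bad = (\<lambda>(S, S'). sum h S' - sum h S) ` (?F \<times> ?F)"
  have fin: "finite ?F" by simp
  have "card bad \<le> card (?F \<times> ?F)"
    unfolding bad_def using fin by (intro card_image_le) auto
  also have "\<dots> = card ?F * card ?F" by (rule card_cartesian_product)
  also have "\<dots> \<le> (n + 1) ^ k * (n + 1) ^ k"
    by (intro mult_mono card_bounded_subsets_le) auto
  also have "\<dots> = (n + 1) ^ (2 * k)" by (simp add: mult_2 power_add)
  also have "\<dots> \<le> (N + 1) ^ (2 * k)" using Suc.prems by (intro power_mono) auto
  also have "\<dots> < card {..(N + 1) ^ (2 * k)}" by simp
  finally have "\<not> {..(N + 1) ^ (2 * k)} \<subseteq> bad"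
    using fin by (auto simp: bad_def dest: card_mono[rotated])
  then obtain v where v: "v \<le> (N + 1) ^ (2 * k)" "v \<notin> bad" by auto
  define h' where "h' = h(Suc n := v)"
  have same: "sum h' S = sum h S" if "Suc n \<notin> S" for S
    using that unfolding h'_def by (intro sum.cong) auto
  have new: "sum h' S = v + sum h (S - {Suc n})" if "Suc n \<in> S" "finite S" for S
    using that sum.remove[of S "Suc n" h'] same[of "S - {Suc n}"] by (simp add: h'_def)
  have diff: "sum h' S \<noteq> sum h' S'"
    if "S \<subseteq> {1..Suc n}" "card S \<le> k" "S' \<subseteq> {1..Suc n}" "card S' \<le> k" "Suc n \<in> S" "Suc n \<notin> S'" for S S'
  proof
    assume eq: "sum h' S = sum h' S'"
    have fS: "finite S" using that finite_subset by blast
    then have "v = sum h S' - sum h (S - {Suc n})"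
      using eq new[of S] same[of S'] that by auto
    moreover have "S - {Suc n} \<in> ?F" "S' \<in> ?F"
      using that fS by (auto simp: card_Diff_singleton_if le_Suc_eq)
    ultimately show False using v(2) unfolding bad_def by force
  qed
  have "inj_on (sum h') {S. S \<subseteq> {1..Suc n} \<and> card S \<le> k}"
  proof (rule inj_onI)
    fix S S'
    assume S: "S \<in> {S. S \<subseteq> {1..Suc n} \<and> card S \<le> k}" and S': "S' \<in> {S. S \<subseteq> {1..Suc n} \<and> card S \<le> k}"
      and eq: "sum h' S = sum h' S'"
    have fS: "finite S" "finite S'" using S S' finite_subset by blast+
    have "Suc n \<in> S \<longleftrightarrow> Suc n \<in> S'"
      using diff[of S S'] diff[of S' S] S S' eq by (metis (no_types, lifting) mem_Collect_eq)
    moreover have "S - {Suc n} \<in> ?F" "S' - {Suc n} \<in> ?F"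
      using S S' fS by (auto simp: card_Diff_singleton_if le_Suc_eq)
    moreover have "sum h (S - {Suc n}) = sum h (S' - {Suc n})"
      using eq new[of S] new[of S'] same[of S] same[of S'] fS calculation(1)
      by (cases "Suc n \<in> S") auto
    ultimately show "S = S'"
      using inj_onD[OF h(2)] by blast
  qed
  moreover have "\<forall>x. h' x \<le> (N + 1) ^ (2 * k)"
    using h(1) v(1) by (simp add: h'_def)
  ultimately show ?case by blast
qed

section \<open>Two-colourings by a union bound\<close>

lemma card_supersets:
  assumes "finite U" "A \<subseteq> U"
  shows "card {B. B \<subseteq> U \<and> A \<subseteq> B} = 2 ^ (card U - card A)"
proof -
  have "{B. B \<subseteq> U \<and> A \<subseteq> B} = (\<lambda>C. A \<union> C) ` Pow (U - A)"
  proof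
    show "{B. B \<subseteq> U \<and> A \<subseteq> B} \<subseteq> (\<lambda>C. A \<union> C) ` Pow (U - A)"
    proof
      fix B assume "B \<in> {B. B \<subseteq> U \<and> A \<subseteq> B}"
      then show "B \<in> (\<lambda>C. A \<union> C) ` Pow (U - A)"
        by (intro image_eqI[of _ _ "B - A"]) auto
    qed
  qed (use assms in auto)
  moreover have "inj_on (\<lambda>C. A \<union> C) (Pow (U - A))"
    by (auto simp: inj_on_def)
  ultimately show ?thesis
    using assms by (simp add: card_image card_Pow card_Diff_subset finite_subset)
qed

text \<open>A random subset of \<open>U\<close> contains a given \<open>A\<close> or is disjoint
  from it with probability at most \<open>2 / 2 ^ C\<close>; the union bound, in counting form,
  leaves a subset doing neither for any \<open>A\<close>. This is Erdos's bound for property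
  B.\<close>

lemma property_B:
  assumes "finite U" "finite \<A>" and A: "\<And>A. A \<in> \<A> \<Longrightarrow> A \<subseteq> U \<and> card A \<ge> C"
    and card: "2 * card \<A> < 2 ^ C"
  shows "\<exists>B. \<forall>A\<in>\<A>. A \<inter> B \<noteq> {} \<and> \<not> A \<subseteq> B"
proof (cases "\<A> = {}")
  case False
  then have CU: "C \<le> card U"
    using A \<open>finite U\<close> by (meson card_mono ex_in_conv le_trans)
  define bad where "bad A = {B. B \<subseteq> U \<and> A \<subseteq> B} \<union> {B. B \<subseteq> U \<and> B \<subseteq> U - A}" for A
  have bad: "card (bad A) \<le> 2 * 2 ^ (card U - C)" if "A \<in> \<A>" for A
  proof -
    have A': "A \<subseteq> U" "C \<le> card A" "finite A"
      using A[OF that] \<open>finite U\<close> finite_subset by auto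
    have "{B. B \<subseteq> U \<and> B \<subseteq> U - A} = Pow (U - A)" by auto
    then have "card {B. B \<subseteq> U \<and> B \<subseteq> U - A} = 2 ^ (card U - card A)"
      using A' \<open>finite U\<close> by (simp add: card_Pow card_Diff_subset)
    then have "card (bad A) \<le> 2 ^ (card U - card A) + 2 ^ (card U - card A)"
      unfolding bad_def using card_Un_le[of "{B. B \<subseteq> U \<and> A \<subseteq> B}" "{B. B \<subseteq> U \<and> B \<subseteq> U - A}"]
        card_supersets[OF \<open>finite U\<close> A'(1)] by simp
    also have "\<dots> \<le> 2 * 2 ^ (card U - C)"
      using A'(2) power_increasing[of "card U - card A" "card U - C" "2::nat"] by linarith
    finally show ?thesis .
  qed
  have "card (\<Union>(bad ` \<A>)) \<le> (\<Sum>A\<in>\<A>. card (bad A))"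
    using \<open>finite \<A>\<close> by (rule card_UN_le)
  also have "\<dots> \<le> (\<Sum>A\<in>\<A>. 2 * 2 ^ (card U - C))"
    using bad by (rule sum_mono)
  also have "\<dots> = (2 * card \<A>) * 2 ^ (card U - C)" by simp
  also have "\<dots> < 2 ^ C * 2 ^ (card U - C)" using card by simp
  also have "\<dots> = card (Pow U)"
    using CU \<open>finite U\<close> by (simp add: card_Pow flip: power_add)
  finally have "\<not> Pow U \<subseteq> \<Union>(bad ` \<A>)"
    using \<open>finite \<A>\<close> \<open>finite U\<close> card_mono[of "\<Union>(bad ` \<A>)" "Pow U"] by (auto simp: bad_def)
  then obtain B where "B \<subseteq> U" "\<forall>A\<in>\<A>. B \<notin> bad A" by auto
  then show ?thesis unfolding bad_def by (intro exI[of _ B]) blast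
qed auto

text \<open>Property B is applied to the sets of sums \<open>sum h (Z \<union> W)\<close>. There are
  at most \<open>2 ^ (L * (4 * K + 1))\<close> of them, and the extra 1 in the exponent accounts for
  the two colours.\<close>

lemma exists_nonconstant_sum_colouring:
  assumes n: "(n::nat) + 1 \<le> 2 ^ L" and K: "L * (4 * K + 1) + 1 < (2 * K choose K)"
  shows "\<exists>h \<phi>. \<forall>Z D b. Z \<subseteq> {1..n} \<longrightarrow> D \<subseteq> {1..n} - Z \<longrightarrow> card D = 2 * K \<longrightarrow>
           (\<exists>W\<subseteq>D. card W = K \<and> \<phi> (sum h (Z \<union> W) :: nat) \<noteq> (b::bool))"
proof -
  obtain h :: "nat \<Rightarrow> nat" where h: "\<And>x. h x \<le> (n + 1) ^ (2 * K)"
      and inj: "inj_on (sum h) {S. S \<subseteq> {1..n} \<and> card S \<le> K}"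
    using exists_distinct_subset_sums[of n n K] by auto
  define T where "T = {..n * (n + 1) ^ (2 * K)}"
  define \<D> where "\<D> = {D. D \<subseteq> {1..n} \<and> card D \<le> 2 * K}"
  have sumT: "sum h X \<in> T" if "X \<subseteq> {1..n}" for X
  proof -
    have "sum h X \<le> card X * (n + 1) ^ (2 * K)"
      using h sum_bounded_above[of X h "(n + 1) ^ (2 * K)"] by simp
    also have "\<dots> \<le> n * (n + 1) ^ (2 * K)"
      using card_mono[OF _ that] by simp
    finally show ?thesis unfolding T_def by simp
  qed
  \<comment> \<open>\<open>Z\<close> enters only through its sum \<open>t\<close>, which avoids
    counting the exponentially many \<open>Z\<close>.\<close>
  define F where "F = (\<lambda>(t, D). (\<lambda>W. t + sum h W) ` nsets D K)"
  \<comment> \<open>A pair \<open>(t, D)\<close> need not come from an actual \<open>Z\<close>; the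
    filter keeps the sets to which \<open>property_B\<close> applies.\<close>
  define \<A> where "\<A> = {A \<in> F ` (T \<times> \<D>). A \<subseteq> T \<and> card A \<ge> (2 * K choose K)}"
  have finT: "finite T" and finD: "finite \<D>" unfolding T_def \<D>_def by auto
  have "card \<A> \<le> card (F ` (T \<times> \<D>))"
    unfolding \<A>_def using finT finD by (intro card_mono) auto
  also have "\<dots> \<le> card (T \<times> \<D>)" using finT finD by (intro card_image_le) auto
  also have "\<dots> = card T * card \<D>" by (rule card_cartesian_product)
  also have "\<dots> \<le> (n + 1) ^ (2 * K + 1) * (n + 1) ^ (2 * K)"
    unfolding \<D>_def by (intro mult_mono card_bounded_subsets_le) (auto simp: T_def)
  also have "\<dots> = (n + 1) ^ (4 * K + 1)"
    unfolding power_add[symmetric] by (rule arg_cong[of _ _ "power (n + 1)"]) simp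
  also have "\<dots> \<le> (2 ^ L) ^ (4 * K + 1)" using n by (rule power_mono) simp
  finally have "card \<A> \<le> 2 ^ (L * (4 * K + 1))"
    unfolding power_mult[symmetric] .
  then have "2 * card \<A> \<le> 2 ^ (L * (4 * K + 1) + 1)" by simp
  also have "\<dots> < 2 ^ (2 * K choose K)" using K by (intro power_strict_increasing) auto
  finally have "\<exists>B. \<forall>A\<in>\<A>. A \<inter> B \<noteq> {} \<and> \<not> A \<subseteq> B"
    using finT finD by (intro property_B[of T _ "2 * K choose K"]) (auto simp: \<A>_def)
  then obtain B where B: "\<And>A. A \<in> \<A> \<Longrightarrow> A \<inter> B \<noteq> {} \<and> \<not> A \<subseteq> B" by blast
  have "\<exists>W\<subseteq>D. card W = K \<and> (sum h (Z \<union> W) \<in> B) \<noteq> b"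
    if Z: "Z \<subseteq> {1..n}" and D: "D \<subseteq> {1..n} - Z" "card D = 2 * K" for Z D b
  proof -
    have fin: "finite Z" "finite D" using Z D finite_subset by blast+
    have sum: "sum h (Z \<union> W) = sum h Z + sum h W" if "W \<in> nsets D K" for W
      using that D fin by (intro sum.union_disjoint) (auto simp: nsets_def)
    have F: "F (sum h Z, D) = (\<lambda>W. sum h (Z \<union> W)) ` nsets D K"
      unfolding F_def using sum by auto
    have "inj_on (\<lambda>W. sum h (Z \<union> W)) (nsets D K)"
    proof (rule inj_onI)
      fix W W' assume W: "W \<in> nsets D K" "W' \<in> nsets D K" "sum h (Z \<union> W) = sum h (Z \<union> W')"
      then have "sum h W = sum h W'" using sum by simp
      then show "W = W'"
        using W(1,2) D(1) by (intro inj_onD[OF inj]) (auto simp: nsets_def)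
    qed
    then have "card (F (sum h Z, D)) = (2 * K choose K)"
      using D(2) by (simp add: F card_image)
    moreover have "F (sum h Z, D) \<subseteq> T"
      unfolding F using Z D(1) by (auto simp: nsets_def intro!: sumT)
    moreover have "(sum h Z, D) \<in> T \<times> \<D>"
      using Z D by (auto simp: \<D>_def sumT)
    ultimately have "F (sum h Z, D) \<in> \<A>" unfolding \<A>_def by auto
    \<comment> \<open>Both colours occur on this set of sums, so some \<open>W\<close> gets the one
      different from \<open>b\<close>.\<close>
    from B[OF this] show ?thesis
      unfolding F by (cases b) (auto simp: nsets_def image_iff)
  qed
  then show ?thesis
    by (intro exI[of _ h] exI[of _ "\<lambda>v. v \<in> B"]) blast
qed

text \<open>Since the central binomial coefficient is at least \<open>4 ^ K / (2 * K)\<close>, it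
  suffices that \<open>2 * K * (4 * K + 2) < 2 ^ K\<close>.\<close>

lemma mult_linear_less_central_binomial:
  assumes "K \<ge> 10" "L \<le> 2 ^ K"
  shows "L * (4 * K + 1) + 1 < (2 * K choose K)"
proof -
  \<comment> \<open>At \<open>K = 10\<close> this reads \<open>840 < 1024\<close>; at
    \<open>K = 9\<close> it fails.\<close>
  have pow: "2 * K * (4 * K + 2) < 2 ^ K"
    using assms(1)
  proof (induction K rule: dec_induct)
    case (step m)
    have "2 * Suc m * (4 * Suc m + 2) = 2 * m * (4 * m + 2) + (16 * m + 12)"
      by (simp add: algebra_simps)
    moreover have "16 * m + 12 \<le> 8 * (m * m) + 4 * m"
      using mult_le_mono1[of 10 m m] step.hyps by linarith
    ultimately show ?case using step.IH by (simp add: algebra_simps)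
  qed simp
  have "L * (4 * K + 1) + 1 \<le> 2 ^ K * (4 * K + 1) + 2 ^ K"
    using assms(2) by (intro add_mono mult_le_mono1) auto
  also have "\<dots> = 2 ^ K * (4 * K + 2)" by (simp add: algebra_simps)
  finally have "L * (4 * K + 1) + 1 \<le> 2 ^ K * (4 * K + 2)" .
  then have "2 * K * (L * (4 * K + 1) + 1) \<le> 2 ^ K * (2 * K * (4 * K + 2))"
    by (metis mult.left_commute mult_le_mono2)
  also have "\<dots> < 2 ^ K * 2 ^ K" using pow by simp
  also have "\<dots> = 4 ^ K" by (simp flip: power_mult_distrib)
  finally have "real (2 * K * (L * (4 * K + 1) + 1)) < 4 ^ K"
    by (metis of_nat_less_iff of_nat_numeral of_nat_power)
  also have "4 ^ K \<le> real (2 * K choose K) * (2 * real K)"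
    using central_binomial_lower_bound[of K] assms(1) by (simp add: field_simps)
  also have "\<dots> = real (2 * K * (2 * K choose K))" by simp
  finally have "2 * K * (L * (4 * K + 1) + 1) < 2 * K * (2 * K choose K)"
    unfolding of_nat_less_iff .
  then show ?thesis unfolding mult_less_cancel1 by (rule conjunct2)
qed

section \<open>The upper bound\<close>

lemma chromatic_number_le:
  "mutual_visibility_coloring G k c \<Longrightarrow> \<chi>\<^sub>\<mu> G \<le> k"
  unfolding mutual_visibility_chromatic_number_def by (rule Least_le) blast

lemma chromatic_number_hypercube_le:
  assumes "n + 1 \<le> 2 ^ L" "L \<le> 2 ^ K" "10 \<le> K"
  shows "\<chi>\<^sub>\<mu> (hypercube n) \<le> 8 * K"
proof -
  obtain h \<phi> where h\<phi>: "\<And>Z D b. Z \<subseteq> {1..n} \<Longrightarrow> D \<subseteq> {1..n} - Z \<Longrightarrow> card D = 2 * K \<Longrightarrow>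
      \<exists>W\<subseteq>D. card W = K \<and> \<phi> (sum h (Z \<union> W) :: nat) \<noteq> (b::bool)"
    using exists_nonconstant_sum_colouring[OF assms(1) mult_linear_less_central_binomial[OF assms(3,2)]]
    by metis
  \<comment> \<open>The residue is recovered as \<open>c X div 2\<close> and the bit as the parity
    of \<open>c X\<close>; there are \<open>4 * K\<close> residues and two bits.\<close>
  define c where "c X = 2 * (card X mod (4 * K)) + of_bool (\<phi> (sum h X))" for X :: "nat set"
  have c: "card X mod (4 * K) = i div 2" "\<phi> (sum h X) = odd i" if "c X = i" for X i
    using that by (auto simp: c_def)
  have "mutual_visibility_set (hypercube n) {X \<in> verts (hypercube n). c X = i}" for i
  proof (rule layered_set.mutual_visibility[where K = K and r = "i div 2"], unfold_locales)
    fix Z D assume "Z \<subseteq> {1..n}" "D \<subseteq> {1..n} - Z" "card D = 2 * K"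
    from h\<phi>[OF this, of "odd i"]
    show "\<exists>W\<subseteq>D. card W = K \<and> Z \<union> W \<notin> {X \<in> verts (hypercube n). c X = i}"
      using c(2) by blast
  qed (use assms(3) c(1) in auto)
  moreover have "c X < 8 * K" for X
  proof -
    have "card X mod (4 * K) < 4 * K" using assms(3) by simp
    moreover have "of_bool (\<phi> (sum h X)) \<le> (1::nat)" by simp
    ultimately show ?thesis unfolding c_def by linarith
  qed
  ultimately have "mutual_visibility_coloring (hypercube n) (8 * K) c"
    by (auto simp: mutual_visibility_coloring_def)
  then show ?thesis by (rule chromatic_number_le)
qed

text \<open>The choices below give \<open>L \<le> 2 * x\<close> and
  \<open>K \<le> log 2 x + 12\<close>. From \<open>n \<ge> 4\<close> follows
  \<open>1 \<le> log 2 x\<close>, so the additive constant is absorbed by the factor.\<close>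

lemma chromatic_number_hypercube_le_log_log:
  assumes "n \<ge> 4"
  shows "real (\<chi>\<^sub>\<mu> (hypercube n)) \<le> 112 * log 2 (log 2 (real n))"
proof -
  define x where "x = log 2 (real n)"
  define L where "L = nat \<lceil>log 2 (real n + 1)\<rceil>"
  \<comment> \<open>The summand 10 secures \<open>10 \<le> K\<close>.\<close>
  define K where "K = nat \<lceil>log 2 (real L)\<rceil> + 10"
  have "log 2 4 \<le> x" using assms unfolding x_def by (intro log_mono) auto
  moreover have "log 2 4 = (2::real)" using log_pow_cancel[of 2 2] by simp
  ultimately have x: "2 \<le> x" by simp
  have "log 2 2 \<le> log 2 x" using x by (intro log_mono) auto
  then have lx: "1 \<le> log 2 x" by simp
  have "real n + 1 \<le> real n * 2" using assms by simp
  then have "log 2 (real n + 1) \<le> log 2 (real n * 2)" using assms by (intro log_mono) auto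
  also have "\<dots> = x + 1" using assms by (simp add: x_def log_mult)
  finally have "log 2 (real n + 1) \<le> x + 1" .
  moreover have pos: "0 < log 2 (real n + 1)" using assms by simp
  ultimately have "real L \<le> x + 2" unfolding L_def by linarith
  then have Lx: "real L \<le> 2 * x" using x by linarith
  have L_ge: "log 2 (real n + 1) \<le> real L" unfolding L_def by linarith
  have "L > 0" using L_ge pos by (cases L) auto
  then have "log 2 (real L) \<le> log 2 (2 * x)" using Lx by (intro log_mono) auto
  also have "\<dots> = 1 + log 2 x" using x by (simp add: log_mult)
  finally have "log 2 (real L) \<le> 1 + log 2 x" .
  then have Kx: "real K \<le> log 2 x + 12" unfolding K_def using lx by linarith
  have "real n + 1 \<le> 2 powr real L" using L_ge assms by (subst (asm) log_le_iff) auto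
  then have "real (n + 1) \<le> real (2 ^ L)" by (simp add: powr_realpow add.commute)
  then have nL: "n + 1 \<le> 2 ^ L" unfolding of_nat_le_iff .
  have "log 2 (real L) \<le> real K" unfolding K_def by linarith
  then have "real L \<le> 2 powr real K" using \<open>L > 0\<close> by (subst (asm) log_le_iff) auto
  then have "real L \<le> real (2 ^ K)" by (simp add: powr_realpow)
  then have LK: "L \<le> 2 ^ K" unfolding of_nat_le_iff .
  have "\<chi>\<^sub>\<mu> (hypercube n) \<le> 8 * K"
    using nL LK by (rule chromatic_number_hypercube_le) (simp add: K_def)
  then have "real (\<chi>\<^sub>\<mu> (hypercube n)) \<le> 8 * real K" by simp
  also have "\<dots> \<le> 112 * log 2 x" using Kx lx by simp
  finally show ?thesis unfolding x_def .
qed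

section \<open>The lower bound\<close>

text \<open>Induction on the number of sizes: the induction hypothesis supplies a set as large as
  Ramsey's theorem for \<open>R\<close>-subsets requires, and passing to a subset of it preserves
  homogeneity for the smaller sizes.\<close>

lemma ramsey_layers:
  "\<exists>N. \<forall>(V :: 'a set) c. finite V \<longrightarrow> N \<le> card V \<longrightarrow> (\<forall>X\<subseteq>V. c X < q) \<longrightarrow>
     (\<exists>S\<subseteq>V. card S = m \<and> (\<forall>r<R. \<exists>i::nat. \<forall>X\<in>nsets S r. c X = i))"
proof (induction R arbitrary: m)
  case 0
  show ?case
    by (intro exI[of _ m]) (auto dest: obtain_subset_with_card_n)
next
  case (Suc R)
  obtain N1 :: nat where N1: "partn_lst {..<N1} (replicate q m) R"
    using ramsey_full by blast
  obtain N where N: "\<And>(V :: 'a set) c. finite V \<Longrightarrow> N \<le> card V \<Longrightarrow> \<forall>X\<subseteq>V. c X < q \<Longrightarrow>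
      \<exists>S\<subseteq>V. card S = N1 \<and> (\<forall>r<R. \<exists>i. \<forall>X\<in>nsets S r. c X = i)"
    using Suc.IH[of N1] by metis
  have "\<exists>S\<subseteq>V. card S = m \<and> (\<forall>r<Suc R. \<exists>i. \<forall>X\<in>nsets S r. c X = i)"
    if V: "finite V" "N \<le> card V" "\<forall>X\<subseteq>V. c X < q" for V :: "'a set" and c
  proof -
    obtain S1 where S1: "S1 \<subseteq> V" "card S1 = N1" "\<forall>r<R. \<exists>i. \<forall>X\<in>nsets S1 r. c X = i"
      using N[OF V] by blast
    have "finite S1" using S1(1) V(1) finite_subset by blast
    \<comment> \<open>\<open>partn_lst\<close> speaks about \<open>{..<N1}\<close>, so the colouring
      is pulled back along a bijection.\<close>
    then obtain e where e: "bij_betw e {..<N1} S1"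
      using ex_bij_betw_nat_finite[of S1] S1(2) by (auto simp: atLeast0LessThan)
    have "e ` Y \<subseteq> V" if "Y \<subseteq> {..<N1}" for Y
      using image_mono[OF that, of e] bij_betw_imp_surj_on[OF e] S1(1) by simp
    then have "(\<lambda>Y. c (e ` Y)) \<in> nsets {..<N1} R \<rightarrow> {..<q}"
      using V(3) by (auto simp: nsets_def)
    then obtain i H where "i < length (replicate q m)" "H \<in> nsets {..<N1} (replicate q m ! i)"
        and H2: "(\<lambda>Y. c (e ` Y)) ` nsets H R \<subseteq> {i}"
      by (rule partn_lstE[OF N1]) simp
    then have H: "H \<in> nsets {..<N1} m" by simp
    have H': "H \<subseteq> {..<N1}" "card H = m" "finite H" using H by (auto simp: nsets_def)
    have inj: "inj_on e H" using e H'(1) by (meson bij_betw_def inj_on_subset)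
    have sub: "e ` H \<subseteq> S1" using e H'(1) by (auto simp: bij_betw_def)
    have "c X = i" if X: "X \<in> nsets (e ` H) R" for X
    proof -
      obtain Y where "Y \<in> nsets H R" "X = e ` Y"
        using nset_image_obtains[OF X inj] by metis
      then show ?thesis using H2 by auto
    qed
    moreover have "\<exists>i. \<forall>X\<in>nsets (e ` H) r. c X = i" if "r < R" for r
      using S1(3) that nsets_mono[OF sub] by blast
    ultimately show ?thesis
      using sub S1(1) H'(2) inj
      by (intro exI[of _ "e ` H"]) (auto simp: card_image less_Suc_eq)
  qed
  then show ?case by (intro exI[of _ N]) blast
qed

text \<open>A shortest path between nested sets only adds elements, so its vertex at position
  \<open>m - card X\<close> has size \<open>m\<close>.\<close>

lemma shortest_vpath_crosses_layer:
  assumes p: "shortest_vpath (hypercube n) X p Y" and sub: "X \<subseteq> Y" "Y \<subseteq> {1..n}"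
    and m: "card X < m" "m < card Y"
  obtains Z where "Z \<in> internal_vertices p" "X \<subseteq> Z" "Z \<subseteq> Y" "card Z = m"
proof -
  have fin: "finite X" "finite Y" using sub finite_subset by (meson finite_atLeastAtMost)+
  have len: "card (sym_diff X Y) = card Y - card X"
    using sub(1) fin(2) by (rule card_sym_diff_subset)
  have walk: "vwalk p (hypercube n)" "hd p = X" "last p = Y"
    using p by (auto simp: shortest_vpath_def vpath_between_def)
  \<comment> \<open>Some geodesic exists, with nothing to avoid; comparison with it shows that
    \<open>p\<close> is one too.\<close>
  obtain q where q: "geodesic n X q Y"
    using visible_chain[OF sub, of "{}"] by (auto simp: visible_def)
  have "vpath_between (hypercube n) X q Y"
    using geodesic_shortest_vpath[OF q] by (simp add: shortest_vpath_def)
  then have "vwalk_length p \<le> vwalk_length q"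
    using p by (simp add: shortest_vpath_def)
  then have "length p = Suc (card (sym_diff X Y))"
    using hypercube_vwalk_length_ge[OF walk(1)] walk q by (simp add: geodesic_def)
  then have geo: "geodesic n X p Y" using walk by (simp add: geodesic_def)
  define i where "i = m - card X"
  have i: "0 < i" "i < length p - 1" "i < length p"
    using m \<open>length p = _\<close> len by (auto simp: i_def)
  define Z where "Z = p ! i"
  have d: "card (sym_diff X Z) = i" "card (sym_diff Z Y) = length p - 1 - i"
    using geodesic_dist[OF geo i(3)] by (auto simp: Z_def)
  have finZ: "finite Z"
    using hypercube_vwalk_finite(2)[OF walk(1)] i(3) by (simp add: Z_def)
  \<comment> \<open>The two differences cover \<open>sym_diff X Y\<close> and their sizes add up to
    its size, so they are disjoint; an element of \<open>X - Z\<close> or \<open>Z - Y\<close> would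
    lie in both.\<close>
  have "card (sym_diff X Z \<union> sym_diff Z Y) + card (sym_diff X Z \<inter> sym_diff Z Y) = card (sym_diff X Y)"
    using card_Un_Int[of "sym_diff X Z" "sym_diff Z Y"] fin finZ d i \<open>length p = _\<close> by simp
  moreover have "card (sym_diff X Y) \<le> card (sym_diff X Z \<union> sym_diff Z Y)"
    using fin finZ by (intro card_mono) auto
  ultimately have "card (sym_diff X Z \<inter> sym_diff Z Y) = 0" by linarith
  moreover have "finite (sym_diff X Z \<inter> sym_diff Z Y)" using fin finZ by auto
  ultimately have "sym_diff X Z \<inter> sym_diff Z Y = {}" using card_0_eq by blast
  then have XZY: "X \<subseteq> Z" "Z \<subseteq> Y" using sub(1) by blast+
  then have "card Z = m"
    using d(1) card_sym_diff_subset[OF XZY(1) finZ] card_mono[OF finZ XZY(1)] m(1) by (simp add: i_def)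
  moreover have "Z \<in> internal_vertices p"
  proof -
    have "butlast (tl p) ! (i - 1) = Z" "i - 1 < length (butlast (tl p))"
      using i by (simp_all add: nth_butlast nth_tl Z_def)
    then show ?thesis unfolding internal_vertices_def using nth_mem by metis
  qed
  ultimately show ?thesis using XZY that by blast
qed

text \<open>Some fibre has three elements; its minimum, its maximum and any further element
  serve.\<close>

lemma pigeonhole_three:
  fixes f :: "nat \<Rightarrow> nat"
  assumes "\<And>r. r < 2 * q + 1 \<Longrightarrow> f r < q"
  obtains i j k where "i < j" "j < k" "k < 2 * q + 1" "f i = f j" "f j = f k"
proof -
  define T where "T v = {r. r < 2 * q + 1 \<and> f r = v}" for v
  have "\<exists>v<q. 3 \<le> card (T v)"
  proof (rule ccontr)
    assume "\<not> ?thesis"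
    then have *: "card (T v) < 3" if "v < q" for v
      using that by (meson not_less)
    have "{..<2 * q + 1} = (\<Union>v<q. T v)" using assms by (auto simp: T_def)
    then have "2 * q + 1 = card (\<Union>v<q. T v)" by (metis card_lessThan)
    also have "\<dots> \<le> (\<Sum>v<q. card (T v))" by (rule card_UN_le) simp
    also have "\<dots> \<le> (\<Sum>v<q. 2)" using * by (intro sum_mono) (simp add: less_Suc_eq_le numeral_3_eq_3 numeral_2_eq_2)
    finally show False by simp
  qed
  then obtain v where v: "3 \<le> card (T v)" by blast
  have fin: "finite (T v)" by (simp add: T_def)
  have "card {Min (T v), Max (T v)} \<le> 2" by (simp add: card_insert_if)
  then have "\<not> T v \<subseteq> {Min (T v), Max (T v)}"
    using v card_mono[of "{Min (T v), Max (T v)}" "T v"] by auto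
  then obtain j where j: "j \<in> T v" "j \<noteq> Min (T v)" "j \<noteq> Max (T v)" by blast
  have "Min (T v) < j" "j < Max (T v)"
    using Min_le[OF fin j(1)] Max_ge[OF fin j(1)] j(2,3) by linarith+
  moreover have "Min (T v) \<in> T v" "Max (T v) \<in> T v"
    using fin j(1) by (auto intro: Min_in Max_in)
  ultimately show ?thesis using that[of "Min (T v)" j "Max (T v)"] j(1) by (auto simp: T_def)
qed

lemma chromatic_number_hypercube_unbounded:
  "\<exists>n0. \<forall>n\<ge>n0. \<chi>\<^sub>\<mu> (hypercube n) > q"
proof -
  \<comment> \<open>A set of \<open>2 * q\<close> elements has subsets of \<open>2 * q + 1\<close>
    sizes, enough for three of them to share a colour.\<close>
  obtain N where N: "\<And>(V :: nat set) c. finite V \<Longrightarrow> N \<le> card V \<Longrightarrow> \<forall>X\<subseteq>V. c X < q \<Longrightarrow>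
      \<exists>S\<subseteq>V. card S = 2 * q \<and> (\<forall>r<2 * q + 1. \<exists>i. \<forall>X\<in>nsets S r. c X = i)"
    using ramsey_layers[where 'a = nat and q = q and m = "2 * q" and R = "2 * q + 1"] by metis
  have "\<not> \<chi>\<^sub>\<mu> (hypercube n) \<le> q" if "N \<le> n" for n
  proof
    assume le: "\<chi>\<^sub>\<mu> (hypercube n) \<le> q"
    obtain c where c: "mutual_visibility_coloring (hypercube n) (\<chi>\<^sub>\<mu> (hypercube n)) c"
      using mutual_visibility_chromatic_number_attained[of "hypercube n"] by auto
    have cq: "c X < \<chi>\<^sub>\<mu> (hypercube n)" if "X \<subseteq> {1..n}" for X
      using c that by (auto simp: mutual_visibility_coloring_def)
    then have "\<forall>X\<subseteq>{1..n}. c X < q" using le by (meson less_le_trans)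
    then obtain S where S: "S \<subseteq> {1..n}" "card S = 2 * q"
        "\<forall>r<2 * q + 1. \<exists>i. \<forall>X\<in>nsets S r. c X = i"
      using N[of "{1..n}" c] \<open>N \<le> n\<close> by auto
    then obtain f where f: "\<And>r X. r < 2 * q + 1 \<Longrightarrow> X \<in> nsets S r \<Longrightarrow> c X = f r"
      by metis
    have finS: "finite S" using S(1) finite_subset by blast
    have "f r < q" if r: "r < 2 * q + 1" for r
    proof -
      obtain X where X: "X \<subseteq> S" "card X = r" "finite X"
        using obtain_subset_with_card_n[of r S] r S(2) by auto
      then have "c X = f r" using f[OF r, of X] by (simp add: nsets_def)
      moreover have "X \<subseteq> {1..n}" using X(1) S(1) by (rule subset_trans)
      ultimately show ?thesis using cq[of X] le by simp
    qed
    then obtain i j k where ijk: "i < j" "j < k" "k < 2 * q + 1" "f i = f j" "f j = f k"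
      using pigeonhole_three by blast
    obtain Y where Y: "Y \<subseteq> S" "card Y = k" "finite Y"
      using obtain_subset_with_card_n[of k S] ijk S(2) by auto
    obtain X where X: "X \<subseteq> Y" "card X = i" "finite X"
      using obtain_subset_with_card_n[of i Y] ijk Y(2) by auto
    define M where "M = {Z \<in> verts (hypercube n). c Z = f j}"
    have inM: "Z \<in> M" if "Z \<subseteq> S" "card Z \<in> {i, j, k}" for Z
      using that f[of "card Z" Z] ijk S(1) finite_subset[OF that(1) finS]
      by (auto simp: M_def nsets_def)
    \<comment> \<open>The colouring \<open>c\<close> may have fewer than \<open>q\<close> colours;
      the vertex \<open>Y\<close> shows that \<open>f j\<close> is among them.\<close>
    have "f j < \<chi>\<^sub>\<mu> (hypercube n)" using inM[of Y] Y cq[of Y] S(1) by (auto simp: M_def)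
    then have "mutual_visibility_set (hypercube n) M"
      using c by (simp add: mutual_visibility_coloring_def M_def)
    moreover have "X \<in> M" "Y \<in> M" using inM X Y by auto
    ultimately obtain p where p: "shortest_vpath (hypercube n) X p Y" "internal_vertices p \<inter> M = {}"
      unfolding mutual_visibility_set_def by blast
    have "Y \<subseteq> {1..n}" using Y(1) S(1) by (rule subset_trans)
    moreover have "card X < j" "j < card Y" using X(2) Y(2) ijk(1,2) by auto
    ultimately obtain Z where "Z \<in> internal_vertices p" "X \<subseteq> Z" "Z \<subseteq> Y" "card Z = j"
      by (rule shortest_vpath_crosses_layer[OF p(1) X(1)])
    then show False using inM[of Z] p(2) Y(1) by auto
  qed
  then show ?thesis by (meson not_le)
qed

theorem theorem2:
  shows "(\<forall>q::nat. q \<ge> 1 \<longrightarrow>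
            (\<exists>n0::nat. \<forall>n\<ge>n0. \<chi>\<^sub>\<mu> (with_proj (hypercube n)) > q)) \<and>
         (\<exists>C::real. C > 0 \<and>
            (\<exists>n1::nat. \<forall>n\<ge>n1. real (\<chi>\<^sub>\<mu> (with_proj (hypercube n))) \<le> C * log 2 (log 2 (real n))))"
proof (intro conjI allI impI)
  show "\<exists>C::real. C > 0 \<and>
      (\<exists>n1::nat. \<forall>n\<ge>n1. real (\<chi>\<^sub>\<mu> (with_proj (hypercube n))) \<le> C * log 2 (log 2 (real n)))"
    using chromatic_number_hypercube_le_log_log by (intro exI[of _ 112]) auto
qed (rule chromatic_number_hypercube_unbounded)

end
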